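(* Let $\mathscr{P}$ be a topological property which is closed hereditary, is preserved under finite closed sums, and satisfies Mr\'{o}wka's condition $(\mathrm{W})$. Let $\mathscr{Q}$ be a topological property which is closed hereditary, satisfies Mr\'{o}wka's condition $(\mathrm{W})$, and implies complete regularity (i.e., every space having $\mathscr{Q}$ is completely regular). If $X$ is a topological space which is locally-$\mathscr{P}$, does not have $\mathscr{P}$, and has $\mathscr{Q}$, then $X$ has a one-point extension $Y$ such that $Y$ has both $\mathscr{P}$ and $\mathscr{Q}$.
   Context: A topological property is a property of topological spaces invariant under homeomorphism. Completely regular spaces are assumed Hausdorff (i.e., they are Tychonoff spaces). Let $\mathscr{P}$ be a topological property. - $\mathscr{P}$ is closed hereditary if any closed subspace of a space with $\mathscr{P}$ also has $\mathscr{P}$. - $\mathscr{P}$ is preserved under finite closed sums if any space which is expressible as a finite union of closed subspaces each having $\mathscr{P}$ also has $\mathscr{P}$. - $\mathscr{P}$ satisfies Mr\'{o}wka's condition $(\mathrm{W})$ if the following holds: if $X$ is a completely regular space in which there exists a point $p$ with an open base $\mathscr{B}$ for $X$ at $p$ such that $X\setminus B$ has $\mathscr{P}$ for every $B\in\mathscr{B}$, then $X$ has $\mathscr{P}$. - A space $X$ is locally-$\mathscr{P}$ if each of its points has a neighborhood in $X$ (as a subspace) with $\mathscr{P}$. A space $Y$ is an extension of a space $X$ if $Y$ contains $X$ as a dense subspace (up to homeomorphic identification). An extension $Y$ of $X$ is a one-point extension of $X$ if $Y\setminus X$ is a singleton. *)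

theory Defs
  imports "HOL-Analysis.Analysis"
begin

text \<open>
  A property of spaces is a predicate on \<open>'a topology\<close>.  Here \<open>'a\<close> only serves as a reservoir of
  points: carriers are arbitrary subsets of it, and spaces are identified up to homeomorphism.
  If \<open>'a\<close> is infinite, a space on it together with one more point again embeds in \<open>'a\<close>.
\<close>

definition topological_property :: "('a topology \<Rightarrow> bool) \<Rightarrow> bool"
  where "topological_property P \<longleftrightarrow> (\<forall>X Y. X homeomorphic_space Y \<longrightarrow> P X \<longrightarrow> P Y)"

definition closed_hereditary :: "('a topology \<Rightarrow> bool) \<Rightarrow> bool"
  where "closed_hereditary P \<longleftrightarrow> (\<forall>X C. P X \<longrightarrow> closedin X C \<longrightarrow> P (subtopology X C))"

text \<open>
  The empty family is a finite family, so the empty space has every property that is preserved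
  under finite closed sums.
\<close>

definition preserved_finite_closed_sums :: "('a topology \<Rightarrow> bool) \<Rightarrow> bool"
  where "preserved_finite_closed_sums P \<longleftrightarrow>
    (\<forall>X \<C>. finite \<C> \<longrightarrow> (\<forall>C\<in>\<C>. closedin X C \<and> P (subtopology X C)) \<longrightarrow>
       \<Union>\<C> = topspace X \<longrightarrow> P X)"

text \<open>The library's \<^const>\<open>completely_regular_space\<close> does not include the Hausdorff axiom.\<close>

definition tychonoff_space :: "'a topology \<Rightarrow> bool"
  where "tychonoff_space X \<longleftrightarrow> completely_regular_space X \<and> Hausdorff_space X"

definition open_base_at :: "'a topology \<Rightarrow> 'a \<Rightarrow> 'a set set \<Rightarrow> bool"
  where "open_base_at X p \<B> \<longleftrightarrow>
    (\<forall>B\<in>\<B>. openin X B \<and> p \<in> B) \<and>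
    (\<forall>U. openin X U \<longrightarrow> p \<in> U \<longrightarrow> (\<exists>B\<in>\<B>. B \<subseteq> U))"

definition mrowka_W :: "('a topology \<Rightarrow> bool) \<Rightarrow> bool"
  where "mrowka_W P \<longleftrightarrow>
    (\<forall>X. tychonoff_space X \<longrightarrow>
       (\<exists>p\<in>topspace X. \<exists>\<B>. open_base_at X p \<B> \<and>
          (\<forall>B\<in>\<B>. P (subtopology X (topspace X - B)))) \<longrightarrow> P X)"

text \<open>Neighborhoods need not be open.\<close>

definition locally_property :: "('a topology \<Rightarrow> bool) \<Rightarrow> 'a topology \<Rightarrow> bool"
  where "locally_property P X \<longleftrightarrow>
    (\<forall>x\<in>topspace X. \<exists>U N. openin X U \<and> x \<in> U \<and> U \<subseteq> N \<and> N \<subseteq> topspace X \<and>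
       P (subtopology X N))"

definition one_point_extension :: "'a topology \<Rightarrow> 'b topology \<Rightarrow> bool"
  where "one_point_extension X Y \<longleftrightarrow>
    (\<exists>e. embedding_map X Y e \<and>
         Y closure_of (e ` topspace X) = topspace Y \<and>
         (\<exists>p. topspace Y - e ` topspace X = {p}))"

end

theory Submission
  imports Defs
begin

text \<open>
  Let \<open>F\<close> be the set of continuous functions \<open>f \<ge> 0\<close> on \<open>X\<close> such that \<open>{f \<ge> \<epsilon>}\<close> has \<open>P\<close> for every
  \<open>\<epsilon> > 0\<close>. Adjoin to \<open>X\<close> a point \<open>p\<close> whose basic neighborhoods are \<open>{p} \<union> {f < 1}\<close> with \<open>f \<in> F\<close>.
  Every \<open>f \<in> F\<close> extends continuously by \<open>0\<close> at \<open>p\<close>, because \<open>F\<close> is closed under positive scaling,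
  and since \<open>X\<close> is locally-\<open>P\<close>, the set \<open>F\<close> separates points of \<open>X\<close> from closed sets. Hence the new
  space is Tychonoff. The complements \<open>{f \<ge> 1}\<close> of the basic neighborhoods have both \<open>P\<close> and \<open>Q\<close>, so
  condition (W) applies to both properties; density of \<open>X\<close> holds because \<open>{f \<ge> 1} = X\<close> would give
  \<open>X\<close> the property \<open>P\<close>.
\<close>

section \<open>Adjoining a point to a space along a family of functions\<close>

locale point_adjunction =
  fixes X :: "'a topology" and F :: "('a \<Rightarrow> real) set" and h :: "'a \<Rightarrow> 'a" and p :: 'a
  assumes t1: "t1_space X"
    and inj: "inj_on h (topspace X)"
    and p_notin: "p \<notin> h ` topspace X"
    and zero: "(\<lambda>_. 0) \<in> F"
    and max: "f \<in> F \<Longrightarrow> g \<in> F \<Longrightarrow> (\<lambda>x. max (f x) (g x)) \<in> F"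
    and scale: "f \<in> F \<Longrightarrow> 0 < c \<Longrightarrow> (\<lambda>x. c * f x) \<in> F"
    and continuous: "f \<in> F \<Longrightarrow> continuous_map X euclideanreal f"
    and nonneg: "f \<in> F \<Longrightarrow> x \<in> topspace X \<Longrightarrow> 0 \<le> f x"
    and separating: "openin X U \<Longrightarrow> x \<in> U \<Longrightarrow> \<exists>f\<in>F. f x = 1 \<and> (\<forall>y\<in>topspace X - U. f y = 0)"
begin

text \<open>The map \<open>h\<close> moves a copy of \<open>X\<close> off \<open>p\<close>, so that
  the enlarged space still lives on the type \<open>'a\<close>. The threshold 1 at \<open>p\<close>
  loses nothing: scaling members of \<open>F\<close> produces every other positive
  threshold.\<close>

definition adjoin :: "'a topology" where
  "adjoin = topology (\<lambda>U. U \<subseteq> insert p (h ` topspace X) \<and> openin X {x \<in> topspace X. h x \<in> U} \<and>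
     (p \<in> U \<longrightarrow> (\<exists>f\<in>F. \<forall>x\<in>topspace X. f x < 1 \<longrightarrow> h x \<in> U)))"

text \<open>Only intersections at \<open>p\<close> need an idea: where
  \<open>max (f x) (g x) < 1\<close>, both \<open>f x < 1\<close> and \<open>g x < 1\<close>, and
  \<open>F\<close> is closed under \<open>max\<close>.\<close>

lemma openin_adjoin:
  "openin adjoin U \<longleftrightarrow> U \<subseteq> insert p (h ` topspace X) \<and> openin X {x \<in> topspace X. h x \<in> U} \<and>
     (p \<in> U \<longrightarrow> (\<exists>f\<in>F. \<forall>x\<in>topspace X. f x < 1 \<longrightarrow> h x \<in> U))"
proof -
  let ?O = "\<lambda>U. U \<subseteq> insert p (h ` topspace X) \<and> openin X {x \<in> topspace X. h x \<in> U} \<and>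
     (p \<in> U \<longrightarrow> (\<exists>f\<in>F. \<forall>x\<in>topspace X. f x < 1 \<longrightarrow> h x \<in> U))"
  have "?O (S \<inter> T)" if S: "?O S" and T: "?O T" for S T
  proof (intro conjI impI)
    show "S \<inter> T \<subseteq> insert p (h ` topspace X)"
      using S by blast
    have "{x \<in> topspace X. h x \<in> S \<inter> T} = {x \<in> topspace X. h x \<in> S} \<inter> {x \<in> topspace X. h x \<in> T}"
      by blast
    then show "openin X {x \<in> topspace X. h x \<in> S \<inter> T}"
      using S T by auto
    assume "p \<in> S \<inter> T"
    then obtain f g where "f \<in> F" "\<forall>x\<in>topspace X. f x < 1 \<longrightarrow> h x \<in> S"
      and "g \<in> F" "\<forall>x\<in>topspace X. g x < 1 \<longrightarrow> h x \<in> T"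
      using S T by blast
    then show "\<exists>f\<in>F. \<forall>x\<in>topspace X. f x < 1 \<longrightarrow> h x \<in> S \<inter> T"
      by (intro bexI[OF _ max[of f g]]) auto
  qed
  moreover have "?O (\<Union>\<K>)" if K: "\<forall>K\<in>\<K>. ?O K" for \<K>
  proof (intro conjI impI)
    show "\<Union>\<K> \<subseteq> insert p (h ` topspace X)"
      using K by blast
    have "{x \<in> topspace X. h x \<in> \<Union>\<K>} = (\<Union>K\<in>\<K>. {x \<in> topspace X. h x \<in> K})"
      by blast
    then show "openin X {x \<in> topspace X. h x \<in> \<Union>\<K>}"
      using K by auto
    assume "p \<in> \<Union>\<K>"
    then obtain K where "K \<in> \<K>" "p \<in> K"
      by blast
    then obtain f where "f \<in> F" "\<forall>x\<in>topspace X. f x < 1 \<longrightarrow> h x \<in> K"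
      using K by blast
    with \<open>K \<in> \<K>\<close> show "\<exists>f\<in>F. \<forall>x\<in>topspace X. f x < 1 \<longrightarrow> h x \<in> \<Union>\<K>"
      by blast
  qed
  ultimately have "istopology ?O"
    unfolding istopology_def by blast
  then show ?thesis
    by (simp add: adjoin_def topology_inverse')
qed

lemma topspace_adjoin [simp]: "topspace adjoin = insert p (h ` topspace X)"
proof -
  have "{x \<in> topspace X. h x \<in> insert p (h ` topspace X)} = topspace X"
    by blast
  then have "openin adjoin (insert p (h ` topspace X))"
    using zero unfolding openin_adjoin by auto
  moreover have "U \<subseteq> insert p (h ` topspace X)" if "openin adjoin U" for U
    using that by (simp add: openin_adjoin)
  ultimately show ?thesis
    unfolding topspace_def by blast
qed

lemma vimage_image_eq: "U \<subseteq> topspace X \<Longrightarrow> {x \<in> topspace X. h x \<in> h ` U} = U"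
  using inj by (auto dest: inj_onD)

lemma openin_adjoin_image:
  assumes "openin X U"
  shows "openin adjoin (h ` U)"
  using openin_subset[OF assms] assms p_notin by (auto simp: openin_adjoin vimage_image_eq)

lemma embedding_map_adjoin: "embedding_map X adjoin h"
proof (rule injective_open_imp_embedding_map)
  show "continuous_map X adjoin h"
    by (auto simp: continuous_map openin_adjoin)
  show "open_map X adjoin h"
    by (simp add: open_map_def openin_adjoin_image)
qed (rule inj)

text \<open>This lets a topological property known for subspaces of \<open>X\<close> pass to their
  copies in \<open>adjoin\<close>.\<close>

lemma homeomorphic_subtopology_adjoin:
  assumes "S \<subseteq> topspace X"
  shows "subtopology X S homeomorphic_space subtopology adjoin (h ` S)"
proof -
  have "homeomorphic_map (subtopology X S)
      (subtopology (subtopology adjoin (h ` topspace X)) (h ` S)) h"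
    using embedding_map_adjoin assms unfolding embedding_map_def
    by (intro homeomorphic_map_subtopologies) auto
  moreover have "h ` topspace X \<inter> h ` S = h ` S"
    using assms by blast
  ultimately show ?thesis
    by (auto simp: subtopology_subtopology homeomorphic_space)
qed

section \<open>Neighborhoods of the new point and their complements\<close>

definition nbhd :: "('a \<Rightarrow> real) \<Rightarrow> 'a set" where
  "nbhd f = insert p (h ` {x \<in> topspace X. f x < 1})"

lemma openin_nbhd:
  assumes "f \<in> F"
  shows "openin adjoin (nbhd f)"
proof -
  have "{x \<in> topspace X. h x \<in> nbhd f} = {x \<in> topspace X. f x \<in> {..<1}}"
    using inj p_notin by (auto simp: nbhd_def dest: inj_onD)
  moreover have "openin X {x \<in> topspace X. f x \<in> {..<1}}"
    using openin_continuous_map_preimage[OF continuous[OF assms], of "{..<1}"] by simp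
  ultimately show ?thesis
    using assms by (auto simp: openin_adjoin nbhd_def)
qed

lemma open_base_at_adjoin: "open_base_at adjoin p (nbhd ` F)"
  unfolding open_base_at_def
proof (intro conjI ballI allI impI)
  fix U assume "openin adjoin U" "p \<in> U"
  then show "\<exists>B\<in>nbhd ` F. B \<subseteq> U"
    by (fastforce simp: openin_adjoin nbhd_def)
qed (auto simp: openin_nbhd nbhd_def[abs_def] intro: openin_nbhd[unfolded nbhd_def])

lemma topspace_diff_nbhd: "topspace adjoin - nbhd f = h ` {x \<in> topspace X. 1 \<le> f x}"
proof -
  have "topspace adjoin - nbhd f = h ` topspace X - h ` {x \<in> topspace X. f x < 1}"
    using p_notin by (auto simp: nbhd_def)
  also have "\<dots> = h ` (topspace X - {x \<in> topspace X. f x < 1})"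
    by (rule inj_on_image_set_diff[OF inj, symmetric]) auto
  also have "topspace X - {x \<in> topspace X. f x < 1} = {x \<in> topspace X. 1 \<le> f x}"
    by auto
  finally show ?thesis .
qed

section \<open>Extension of functions and the Tychonoff property\<close>

lemma continuous_extension:
  assumes f: "f \<in> F"
  obtains g where "continuous_map adjoin euclideanreal g" "g p = 0"
    "\<And>x. x \<in> topspace X \<Longrightarrow> g (h x) = f x"
proof -
  define g where "g y = (if y = p then 0 else f (inv_into (topspace X) h y))" for y
  have gp: "g p = 0"
    by (simp add: g_def)
  have gh: "g (h x) = f x" if "x \<in> topspace X" for x
    using that p_notin inj by (auto simp: g_def)
  have "openin adjoin {y \<in> topspace adjoin. g y \<in> V}" if V: "open V" for V
    unfolding openin_adjoin
  proof (intro conjI impI)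
    have "{x \<in> topspace X. h x \<in> {y \<in> topspace adjoin. g y \<in> V}} = {x \<in> topspace X. g (h x) \<in> V}"
      by auto
    also have "\<dots> = {x \<in> topspace X. f x \<in> V}"
      using gh by auto
    finally show "openin X {x \<in> topspace X. h x \<in> {y \<in> topspace adjoin. g y \<in> V}}"
      using openin_continuous_map_preimage[OF continuous[OF f], of V] V by simp
    assume "p \<in> {y \<in> topspace adjoin. g y \<in> V}"
    then have "0 \<in> V"
      by (simp add: g_def)
    then obtain e where e: "e > 0" "ball 0 e \<subseteq> V"
      using V openE by blast
    \<comment> \<open>Here scaling enters: \<open>f x < e\<close> says that
      \<open>inverse e * f x < 1\<close>, which describes a basic neighborhood of
      \<open>p\<close>.\<close>
    have "g (h x) \<in> V" if "x \<in> topspace X" "inverse e * f x < 1" for x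
    proof -
      have "f x < e"
        using that(2) e(1) by (simp add: field_simps)
      then have "f x \<in> ball 0 e"
        using nonneg[OF f that(1)] by simp
      then show ?thesis
        using e(2) gh[OF that(1)] by auto
    qed
    then show "\<exists>k\<in>F. \<forall>x\<in>topspace X. k x < 1 \<longrightarrow> h x \<in> {y \<in> topspace adjoin. g y \<in> V}"
      using scale[OF f, of "inverse e"] e(1)
      by (intro bexI[of _ "\<lambda>x. inverse e * f x"]) auto
  qed auto
  then have "continuous_map adjoin euclideanreal g"
    by (auto simp: continuous_map)
  then show thesis
    using gp gh by (rule that)
qed

lemma closedin_adjoin_singleton:
  assumes "y \<in> topspace adjoin"
  shows "closedin adjoin {y}"
proof (cases "y = p")
  case True
  have "topspace adjoin - {p} = h ` topspace X"
    using p_notin by auto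
  then show ?thesis
    using True openin_adjoin_image[of "topspace X"] by (simp add: closedin_def)
next
  case False
  then obtain x where x: "x \<in> topspace X" "y = h x"
    using assms by auto
  then obtain f where f: "f \<in> F" "f x = 1"
    using separating[OF openin_topspace] by blast
  have "openin X (topspace X - {x})"
    using t1 x by (simp add: closedin_t1_singleton openin_diff)
  \<comment> \<open>The complement of \<open>y\<close> is a union of two open sets:
    \<open>nbhd f\<close> supplies \<open>p\<close> and misses \<open>h x\<close> because
    \<open>f x = 1\<close>, and the other set supplies the remaining points.\<close>
  then have "openin adjoin (nbhd f \<union> h ` (topspace X - {x}))"
    using openin_nbhd[OF f(1)] openin_adjoin_image by blast
  moreover have "nbhd f \<union> h ` (topspace X - {x}) = topspace adjoin - {y}"
    using x f p_notin inj by (auto simp: nbhd_def dest: inj_onD)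
  ultimately show ?thesis
    using assms by (simp add: closedin_def)
qed

text \<open>Both kinds of points are handled by extending members of \<open>F\<close>. At
  \<open>p\<close>, a function whose basic neighborhood lies in \<open>S\<close> is truncated at 1.
  At \<open>h x\<close>, one takes 1 minus the extension of a function separating \<open>x\<close>
  from the complement of the trace of \<open>S\<close>.\<close>

lemma completely_regular_space_adjoin: "completely_regular_space adjoin"
  unfolding completely_regular_space_alt'
proof (intro allI impI)
  fix S y assume S: "openin adjoin S" and y: "y \<in> S"
  show "\<exists>g. continuous_map adjoin euclideanreal g \<and> g y = 0 \<and> g ` (topspace adjoin - S) \<subseteq> {1}"
  proof (cases "y = p")
    case True
    then obtain f where f: "f \<in> F" "\<forall>x\<in>topspace X. f x < 1 \<longrightarrow> h x \<in> S"
      using S y by (auto simp: openin_adjoin)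
    from continuous_extension[OF f(1)] obtain g where g: "continuous_map adjoin euclideanreal g"
      "g p = 0" "\<And>x. x \<in> topspace X \<Longrightarrow> g (h x) = f x" by blast
    have one: "min (g z) 1 = 1" if z: "z \<in> topspace adjoin - S" for z
    proof -
      obtain x where x: "x \<in> topspace X" "z = h x"
        using z True y by auto
      then have "\<not> f x < 1"
        using z f(2) by blast
      then show ?thesis
        using g(3) x by simp
    qed
    show ?thesis
    proof (intro exI conjI)
      show "continuous_map adjoin euclideanreal (\<lambda>z. min (g z) 1)"
        using g(1) by (intro continuous_map_real_min) auto
      show "min (g y) 1 = 0"
        using True g(2) by simp
      show "(\<lambda>z. min (g z) 1) ` (topspace adjoin - S) \<subseteq> {1}"
        by (intro image_subsetI) (simp only: one singleton_iff)
    qed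
  next
    case False
    then obtain x where x: "x \<in> topspace X" "y = h x"
      using openin_subset[OF S] y by auto
    have "openin X {x \<in> topspace X. h x \<in> S}"
      using S by (simp add: openin_adjoin)
    then obtain f where f: "f \<in> F" "f x = 1" "\<forall>z\<in>topspace X - {x \<in> topspace X. h x \<in> S}. f z = 0"
      using separating[of "{x \<in> topspace X. h x \<in> S}" x] x y by blast
    from continuous_extension[OF f(1)] obtain g where g: "continuous_map adjoin euclideanreal g"
      "g p = 0" "\<And>x. x \<in> topspace X \<Longrightarrow> g (h x) = f x" by blast
    \<comment> \<open>The extension vanishes at \<open>p\<close> as well, so it does not matter
      whether \<open>p\<close> belongs to \<open>S\<close>.\<close>
    have one: "1 - g z = 1" if z: "z \<in> topspace adjoin - S" for z
    proof (cases "z = p")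
      case True
      then show ?thesis
        using g(2) by simp
    next
      case False
      then obtain x where "x \<in> topspace X" "z = h x"
        using z by auto
      then show ?thesis
        using z f(3) g(3) by simp
    qed
    show ?thesis
    proof (intro exI conjI)
      show "continuous_map adjoin euclideanreal (\<lambda>z. 1 - g z)"
        using g(1) by (intro continuous_map_diff) auto
      show "1 - g y = 0"
        using x f(2) g(3) by simp
      show "(\<lambda>z. 1 - g z) ` (topspace adjoin - S) \<subseteq> {1}"
        by (intro image_subsetI) (simp only: one singleton_iff)
    qed
  qed
qed

lemma tychonoff_space_adjoin: "tychonoff_space adjoin"
proof -
  have "t1_space adjoin"
    unfolding t1_space_closedin_singleton by (intro ballI closedin_adjoin_singleton)
  with completely_regular_imp_regular_space[OF completely_regular_space_adjoin]
  have "Hausdorff_space adjoin"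
    by (rule regular_t1_imp_Hausdorff_space)
  with completely_regular_space_adjoin show ?thesis
    by (simp add: tychonoff_space_def)
qed

section \<open>Transfer of properties by condition (W), and density\<close>

text \<open>The complements of the basic neighborhoods of \<open>p\<close> are homeomorphic to the
  sets \<open>{f \<ge> 1}\<close>, so (W) applies at \<open>p\<close>.\<close>

lemma property_adjoin:
  assumes "topological_property R" "mrowka_W R"
    and "\<And>f. f \<in> F \<Longrightarrow> R (subtopology X {x \<in> topspace X. 1 \<le> f x})"
  shows "R adjoin"
proof -
  have "R (subtopology adjoin (topspace adjoin - B))" if "B \<in> nbhd ` F" for B
  proof -
    obtain f where f: "f \<in> F" "B = nbhd f"
      using \<open>B \<in> nbhd ` F\<close> by blast
    have "subtopology X {x \<in> topspace X. 1 \<le> f x}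
        homeomorphic_space subtopology adjoin (topspace adjoin - B)"
      unfolding f topspace_diff_nbhd by (rule homeomorphic_subtopology_adjoin) blast
    then show ?thesis
      using assms(1,3) f(1) unfolding topological_property_def by blast
  qed
  moreover have "p \<in> topspace adjoin"
    by simp
  ultimately show ?thesis
    using assms(2) tychonoff_space_adjoin open_base_at_adjoin unfolding mrowka_W_def by blast
qed

text \<open>The assumption says that every basic neighborhood of \<open>p\<close> meets the copy of
  \<open>X\<close>, which puts \<open>p\<close> in its closure.\<close>

lemma one_point_extension_adjoin:
  assumes "\<And>f. f \<in> F \<Longrightarrow> \<exists>x\<in>topspace X. f x < 1"
  shows "one_point_extension X adjoin"
  unfolding one_point_extension_def
proof (intro exI conjI)
  show "embedding_map X adjoin h"
    by (rule embedding_map_adjoin)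
  show "topspace adjoin - h ` topspace X = {p}"
    using p_notin by auto
  have "\<exists>y\<in>h ` topspace X. y \<in> U" if "p \<in> U" "openin adjoin U" for U
    using that assms by (fastforce simp: openin_adjoin)
  then have "p \<in> adjoin closure_of (h ` topspace X)"
    by (auto simp: in_closure_of)
  moreover have "h ` topspace X \<subseteq> adjoin closure_of (h ` topspace X)"
    by (rule closure_of_subset) auto
  ultimately show "adjoin closure_of (h ` topspace X) = topspace adjoin"
    using closure_of_subset_topspace[of adjoin "h ` topspace X"] by auto
qed

end

section \<open>The family of functions determined by \<open>P\<close>\<close>

text \<open>If \<open>P\<close> is compactness, these are the nonnegative continuous functions
  vanishing at infinity. Quantifying over all \<open>e > 0\<close> makes the family closed under
  positive scaling.\<close>

definition vanishing_functions :: "('a topology \<Rightarrow> bool) \<Rightarrow> 'a topology \<Rightarrow> ('a \<Rightarrow> real) set" where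
  "vanishing_functions P X = {f. continuous_map X euclideanreal f \<and> (\<forall>x\<in>topspace X. 0 \<le> f x) \<and>
     (\<forall>e>0. P (subtopology X {x \<in> topspace X. e \<le> f x}))}"

lemma closedin_superlevel:
  assumes "continuous_map X euclideanreal f"
  shows "closedin X {x \<in> topspace X. e \<le> f x}"
  using closedin_continuous_map_preimage[OF assms, of "{e..}"] by simp

text \<open>A set closed in \<open>X\<close> is closed in every subspace containing it, so
  \<open>N\<close> itself may fail to be closed. This suits neighborhoods with \<open>P\<close>,
  which can be arbitrary.\<close>

lemma closed_hereditary_subset:
  assumes P: "closed_hereditary P" and N: "P (subtopology X N)" and C: "closedin X C" "C \<subseteq> N"
  shows "P (subtopology X C)"
proof -
  have "closedin (subtopology X N) C"
    using C by (simp add: closedin_subset_topspace)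
  then have "P (subtopology (subtopology X N) C)"
    using P N unfolding closed_hereditary_def by blast
  moreover have "N \<inter> C = C"
    using C by blast
  ultimately show ?thesis
    by (simp add: subtopology_subtopology)
qed

lemma preserved_finite_closed_sums_empty:
  assumes "preserved_finite_closed_sums P" "topspace X = {}"
  shows "P X"
  using assms(1)[unfolded preserved_finite_closed_sums_def, rule_format, of "{}" X] assms(2) by simp

lemma preserved_finite_closed_sums_Un:
  assumes P: "preserved_finite_closed_sums P"
    and S: "closedin X S" "P (subtopology X S)" and T: "closedin X T" "P (subtopology X T)"
  shows "P (subtopology X (S \<union> T))"
proof -
  let ?Z = "subtopology X (S \<union> T)"
  have "(S \<union> T) \<inter> S = S" "(S \<union> T) \<inter> T = T"
    by blast+
  then have "\<forall>C\<in>{S, T}. closedin ?Z C \<and> P (subtopology ?Z C)"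
    using S T by (simp add: subtopology_subtopology closedin_subset_topspace)
  moreover have "\<Union>{S, T} = topspace ?Z"
    using S(1) T(1) closedin_subset by fastforce
  moreover have "finite {S, T}"
    by simp
  ultimately show ?thesis
    using P unfolding preserved_finite_closed_sums_def by blast
qed

text \<open>Complete regularity gives a function supported inside a neighborhood \<open>N\<close>
  with \<open>P\<close>; its sets \<open>{f \<ge> e}\<close> are closed in \<open>X\<close> and lie
  in \<open>N\<close>, hence inherit \<open>P\<close>.\<close>

lemma vanishing_functions_separating:
  assumes P: "closed_hereditary P" "preserved_finite_closed_sums P" "locally_property P X"
    and X: "completely_regular_space X" and U: "openin X U" "x \<in> U"
  shows "\<exists>f\<in>vanishing_functions P X. f x = 1 \<and> (\<forall>y\<in>topspace X - U. f y = 0)"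
proof -
  have "x \<in> topspace X"
    using U openin_subset by blast
  then obtain V N where V: "openin X V" "x \<in> V" "V \<subseteq> N" "P (subtopology X N)"
    using P(3)[unfolded locally_property_def, rule_format, of x] by metis
  have "openin X (U \<inter> V)" "x \<in> U \<inter> V"
    using U V by auto
  then obtain g where g: "continuous_map X euclideanreal g" "g x = 0"
    "g ` (topspace X - U \<inter> V) \<subseteq> {1}"
    using X[unfolded completely_regular_space_alt', rule_format, of "U \<inter> V" x] by blast
  \<comment> \<open>Reversing \<open>g\<close> gives 1 at \<open>x\<close> and 0 off
    \<open>U \<inter> V\<close>; the maximum with 0 is taken because \<open>g\<close> may exceed
    1.\<close>
  define f where "f y = max 0 (1 - g y)" for y
  have cont: "continuous_map X euclideanreal f"
    unfolding f_def[abs_def] using g(1)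
    by (intro continuous_map_real_max continuous_map_diff) auto
  have zero: "f y = 0" if "y \<in> topspace X - U \<inter> V" for y
    using that g(3) by (auto simp: f_def)
  have "P (subtopology X {y \<in> topspace X. e \<le> f y})" if "e > 0" for e
  proof (rule closed_hereditary_subset[OF P(1) V(4) closedin_superlevel[OF cont]])
    show "{y \<in> topspace X. e \<le> f y} \<subseteq> N"
    proof
      fix y assume "y \<in> {y \<in> topspace X. e \<le> f y}"
      then have "y \<in> U \<inter> V"
        using zero[of y] that by force
      then show "y \<in> N"
        using V(3) by blast
    qed
  qed
  moreover have "0 \<le> f y" for y
    by (simp add: f_def)
  ultimately have "f \<in> vanishing_functions P X"
    using cont by (simp add: vanishing_functions_def)
  moreover have "f x = 1"
    using g(2) by (simp add: f_def)
  moreover have "\<forall>y\<in>topspace X - U. f y = 0"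
    using zero by blast
  ultimately show ?thesis
    by blast
qed

lemma point_adjunction_vanishing_functions:
  assumes P: "closed_hereditary P" "preserved_finite_closed_sums P" "locally_property P X"
    and X: "tychonoff_space X" and h: "inj_on h (topspace X)" "p \<notin> h ` topspace X"
  shows "point_adjunction X (vanishing_functions P X) h p"
proof
  show "t1_space X"
    using X by (simp add: tychonoff_space_def Hausdorff_imp_t1_space)
  show "(\<lambda>_. 0) \<in> vanishing_functions P X"
    \<comment> \<open>For the zero function every set \<open>{f \<ge> e}\<close> with
      \<open>e > 0\<close> is empty, and the empty space has \<open>P\<close>.\<close>
    by (auto simp: vanishing_functions_def intro!: preserved_finite_closed_sums_empty[OF P(2)])
  show "(\<lambda>x. max (f x) (g x)) \<in> vanishing_functions P X"
    if "f \<in> vanishing_functions P X" "g \<in> vanishing_functions P X" for f g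
  proof -
    \<comment> \<open>Closure under \<open>max\<close> thus reduces to finite closed sums of two
      sets.\<close>
    have "{x \<in> topspace X. e \<le> max (f x) (g x)} =
        {x \<in> topspace X. e \<le> f x} \<union> {x \<in> topspace X. e \<le> g x}" for e
      by (auto simp: le_max_iff_disj)
    then show ?thesis
      using that by (auto simp: vanishing_functions_def le_max_iff_disj
          intro!: continuous_map_real_max preserved_finite_closed_sums_Un[OF P(2)] closedin_superlevel)
  qed
  show "(\<lambda>x. c * f x) \<in> vanishing_functions P X" if "f \<in> vanishing_functions P X" "0 < c" for f c
  proof -
    have "{x \<in> topspace X. e \<le> c * f x} = {x \<in> topspace X. e / c \<le> f x}" for e
      using that(2) by (auto simp: field_simps)
    then show ?thesis
      using that by (auto simp: vanishing_functions_def intro!: continuous_map_real_mult)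
  qed
  show "\<exists>f\<in>vanishing_functions P X. f x = 1 \<and> (\<forall>y\<in>topspace X - U. f y = 0)"
    if "openin X U" "x \<in> U" for U x
    using vanishing_functions_separating[OF P _ that] X by (simp add: tychonoff_space_def)
qed (use h in \<open>auto simp: vanishing_functions_def\<close>)

theorem theorem2p5:
  fixes P Q :: "'a topology \<Rightarrow> bool"
    and X :: "'a topology"
  assumes "infinite (UNIV :: 'a set)"
    and "topological_property P"
    and "closed_hereditary P"
    and "preserved_finite_closed_sums P"
    and "mrowka_W P"
    and "topological_property Q"
    and "closed_hereditary Q"
    and "mrowka_W Q"
    and "\<forall>Z. Q Z \<longrightarrow> tychonoff_space Z"
    and "locally_property P X"
    and "\<not> P X"
    and "Q X"
  shows "\<exists>Y :: 'a topology. one_point_extension X Y \<and> P Y \<and> Q Y"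
proof -
  \<comment> \<open>An infinite type is in bijection with itself minus a point; the omitted point
    becomes the new one.\<close>
  obtain h :: "'a \<Rightarrow> 'a" and p where "bij_betw h UNIV (UNIV - {p})"
    using infinite_imp_bij_betw[OF assms(1)] by blast
  then have "inj_on h (topspace X)" "p \<notin> h ` topspace X"
    by (auto simp: bij_betw_def intro: inj_on_subset)
  moreover have "tychonoff_space X"
    using assms(9)[rule_format, OF assms(12)] .
  ultimately interpret point_adjunction X "vanishing_functions P X" h p
    using point_adjunction_vanishing_functions[OF assms(3,4,10)] by metis
  have P: "P (subtopology X {x \<in> topspace X. 1 \<le> f x})" if "f \<in> vanishing_functions P X" for f
    using that by (simp add: vanishing_functions_def)
  \<comment> \<open>The set is closed in \<open>X\<close>, so it inherits \<open>Q\<close> from the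
    whole space.\<close>
  have "Q (subtopology X {x \<in> topspace X. 1 \<le> f x})" if "f \<in> vanishing_functions P X" for f
    using assms(7)[unfolded closed_hereditary_def, rule_format, OF assms(12)]
      closedin_superlevel[OF continuous[OF that]] .
  then have "Q adjoin"
    by (rule property_adjoin[OF assms(6,8)])
  moreover have "P adjoin"
    by (rule property_adjoin[OF assms(2,5) P])
  moreover have "one_point_extension X adjoin"
  proof (rule one_point_extension_adjoin, rule ccontr)
    fix f assume f: "f \<in> vanishing_functions P X" and "\<not> (\<exists>x\<in>topspace X. f x < 1)"
    \<comment> \<open>If \<open>p\<close> were isolated from \<open>X\<close>, some \<open>f\<close>
      would satisfy \<open>f \<ge> 1\<close> everywhere, and \<open>X\<close> itself would have
      \<open>P\<close>.\<close>
    then have "{x \<in> topspace X. 1 \<le> f x} = topspace X"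
      by force
    then show False
      using P[OF f] \<open>\<not> P X\<close> by simp
  qed
  ultimately show ?thesis
    by blast
qed

end
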